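(* Let $A$ be a (possibly infinite) alphabet and let $<$ be the generalized lexicographic order induced by a sequence $(<_n)_{n\in\mathbb{N}}$ of total orders on $A$. Let $w$ be an infinite word over $A$ that has a (not necessarily proper) suffix which is an infinite generalized Lyndon word. Then $w$ has a unique nonincreasing factorization into generalized Lyndon words, and this factorization has finitely many terms. Furthermore, the last term of this factorization is the first generalized Lyndon suffix of $w$ by index, i.e. the suffix $w[j,\infty)$ of $w$ with $j\in\mathbb{N}$ minimal such that $w[j,\infty)$ is an infinite generalized Lyndon word.
   Context: $\mathbb{N}=\{1,2,3,\dots\}$. Words are finite or infinite (to the right) sequences of letters of $A$. For an infinite word $w$, $w[j,\infty)$ denotes the suffix of $w$ beginning at its $j$-th letter. For each $n\in\mathbb{N}$ let $<_n$ be a total order on $A$. The generalized lexicographic order $<$ induced by $(<_n)_{n\in\mathbb{N}}$ on finite and infinite words is: $x<y$ if and only if $x$ is a proper prefix of $y$, or $x=pas$ and $y=pbs'$ for words $p,s,s'$ ($p$ finite) and letters $a,b$ with $a<_{|p|+1}b$. For a nonempty finite word $u$, $u^\omega$ is the infinite word $uuu\cdots$; if $u$ is infinite, $u^\omega=u$ by convention. A nonempty finite word $w$ is generalized Lyndon if $uv<vu$ for every factorization $w=uv$ with $u,v$ both nonempty. An infinite word $w$ is generalized Lyndon if $w<v$ for every factorization $w=uv$ with $u$ a nonempty finite word. A nonincreasing generalized Lyndon factorization of a word $w$ is a product $w=\prod_{i=1}^n\ell_i$ with $n\in\mathbb{N}\cup\{\infty\}$, each $\ell_i$ generalized Lyndon,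 and $\ell_i^\omega\ge\ell_{i+1}^\omega$ for all $i\in[1,n)$; only the last factor of a factorization with finitely many terms may be an infinite word. *)

theory Defs
  imports Main "HOL-Library.Omega_Words_Fun"
begin

text \<open>The alphabet is the type of letters.  Infinite words are the \<open>\<omega>\<close>-words
  of the library, so their letters are indexed from 0.\<close>

datatype 'a gword = FinW "'a list" | InfW "'a word"

text \<open>Concatenation.  The clause for an infinite left factor is only a totalization;
  factorizations below never multiply anything to the right of an infinite word.\<close>

fun gconc :: "'a gword \<Rightarrow> 'a gword \<Rightarrow> 'a gword" where
  "gconc (FinW u) (FinW v) = FinW (u @ v)"
| "gconc (FinW u) (InfW v) = InfW (u \<frown> v)"
| "gconc (InfW u) _ = InfW u"

definition gproper_prefix :: "'a gword \<Rightarrow> 'a gword \<Rightarrow> bool" where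
  "gproper_prefix x y \<longleftrightarrow> (\<exists>p s. x = FinW p \<and> s \<noteq> FinW [] \<and> y = gconc (FinW p) s)"

text \<open>The family \<open>R\<close> of strict orders on the letters is indexed from 1; \<open>R 0\<close> is never
  used.  The order \<open>R n\<close> compares the \<open>n\<close>-th letters of words.\<close>

definition gless :: "(nat \<Rightarrow> 'a rel) \<Rightarrow> 'a gword \<Rightarrow> 'a gword \<Rightarrow> bool" where
  "gless R x y \<longleftrightarrow>
     gproper_prefix x y \<or>
     (\<exists>p a b s s'. x = gconc (FinW (p @ [a])) s \<and> y = gconc (FinW (p @ [b])) s' \<and>
                   (a, b) \<in> R (length p + 1))"

definition gle :: "(nat \<Rightarrow> 'a rel) \<Rightarrow> 'a gword \<Rightarrow> 'a gword \<Rightarrow> bool" where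
  "gle R x y \<longleftrightarrow> x = y \<or> gless R x y"

text \<open>Only meaningful on words other than \<open>FinW []\<close>, where \<open>iter\<close> is unspecified.\<close>

fun gomega :: "'a gword \<Rightarrow> 'a gword" where
  "gomega (FinW u) = InfW (u\<^sup>\<omega>)"
| "gomega (InfW u) = InfW u"

fun gen_lyndon :: "(nat \<Rightarrow> 'a rel) \<Rightarrow> 'a gword \<Rightarrow> bool" where
  "gen_lyndon R (FinW w) \<longleftrightarrow>
     w \<noteq> [] \<and>
     (\<forall>u v. w = u @ v \<and> u \<noteq> [] \<and> v \<noteq> [] \<longrightarrow> gless R (FinW (u @ v)) (FinW (v @ u)))"
| "gen_lyndon R (InfW w) \<longleftrightarrow>
     (\<forall>u v. w = u \<frown> v \<and> u \<noteq> [] \<longrightarrow> gless R (InfW w) (InfW v))"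

text \<open>The product of a finite list of words.\<close>

definition gprod :: "'a gword list \<Rightarrow> 'a gword" where
  "gprod ls = foldr gconc ls (FinW [])"

text \<open>A factorization with finitely or infinitely many terms is itself a finite or infinite
  word, whose letters are the factors.  Its factors \<open>\<ell>\<^sub>1, \<ell>\<^sub>2, \<dots>\<close> sit at positions
  0, 1, and so on.  For an infinite sequence of nonempty finite words, \<open>w\<close> is their product
  iff every finite partial product is a proper prefix of \<open>w\<close>.\<close>

fun nonincreasing_lyndon_factorization ::
    "(nat \<Rightarrow> 'a rel) \<Rightarrow> 'a gword \<Rightarrow> 'a gword gword \<Rightarrow> bool" where
  "nonincreasing_lyndon_factorization R w (FinW ls) \<longleftrightarrow>
     ls \<noteq> [] \<and>
     (\<forall>l \<in> set ls. gen_lyndon R l) \<and>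
     (\<forall>l \<in> set (butlast ls). \<exists>u. l = FinW u) \<and>
     (\<forall>i. Suc i < length ls \<longrightarrow> gle R (gomega (ls ! Suc i)) (gomega (ls ! i))) \<and>
     w = gprod ls"
| "nonincreasing_lyndon_factorization R w (InfW ls) \<longleftrightarrow>
     (\<forall>i. gen_lyndon R (ls i)) \<and>
     (\<forall>i. \<exists>u. ls i = FinW u) \<and>
     (\<forall>i. gle R (gomega (ls (Suc i))) (gomega (ls i))) \<and>
     (\<forall>k. gproper_prefix (gprod (map ls [0..<k])) w)"

end

theory Submission
  imports Defs
begin

text \<open>The order is not invariant under a common left factor, so every comparison is made at the
  first difference from the start of the words.  Two facts replace invariance: \<open>u \<frown> z\<close> and \<open>z\<close>
  first differ exactly as \<open>u\<^sup>\<omega>\<close> and \<open>z\<close> do, and \<open>(u @ v)\<^sup>\<omega>\<close> coincides with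
  \<open>u\<^sup>\<omega>\<close> up to and including the first difference of \<open>u\<^sup>\<omega>\<close> and \<open>v\<^sup>\<omega>\<close>.  Hence a finite
  word is generalized Lyndon iff \<open>u\<^sup>\<omega> < v\<^sup>\<omega>\<close> for all its proper splittings \<open>u @ v\<close>.

  For uniqueness, every nonempty suffix \<open>s\<close> of a nonincreasing product of finite Lyndon words
  satisfies \<open>s\<^sup>\<omega> \<ge> \<ell>\<^sup>\<omega>\<close>, where \<open>\<ell>\<close> is the last factor.  So no Lyndon suffix of \<open>w\<close> starts before the
  last factor.  For existence, split off a minimal suffix.  (Merging adjacent Lyndon words
  \<open>u\<close>, \<open>v\<close> with \<open>u\<^sup>\<omega> < v\<^sup>\<omega>\<close>, as for the usual order, fails: \<open>u @ v\<close> need not be Lyndon.)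

  Infinite factorizations are excluded by descent.  If a Lyndon suffix \<open>v\<^sub>0\<close> is a product
  \<open>y\<^sub>0 y\<^sub>1 \<dots>\<close> with nonincreasing \<open>y\<^sub>n\<^sup>\<omega>\<close>, then \<open>v\<^sub>0\<close> is smaller than each of its tails
  \<open>v\<^sub>n = y\<^sub>n y\<^sub>n\<^sub>+\<^sub>1 \<dots>\<close>, and the position of the first difference of \<open>v\<^sub>0\<close> and \<open>v\<^sub>n\<close>
  strictly decreases with \<open>n \<ge> 1\<close>.\<close>

section \<open>Agreement of infinite words up to a position; periodic words\<close>

definition agree :: "nat \<Rightarrow> 'a word \<Rightarrow> 'a word \<Rightarrow> bool" where
  "agree n x y \<longleftrightarrow> (\<forall>i<n. x i = y i)"

lemma agree_refl [simp]: "agree n x x"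
  by (simp add: agree_def)

lemma agree_0 [simp]: "agree 0 x y"
  by (simp add: agree_def)

lemma agree_Suc: "agree (Suc n) x y \<longleftrightarrow> agree n x y \<and> x n = y n"
  by (auto simp: agree_def less_Suc_eq)

lemma agree_sym: "agree n x y \<Longrightarrow> agree n y x"
  by (simp add: agree_def)

lemma agree_trans: "agree n x y \<Longrightarrow> agree n y z \<Longrightarrow> agree n x z"
  by (simp add: agree_def)

lemma agree_mono: "agree n x y \<Longrightarrow> m \<le> n \<Longrightarrow> agree m x y"
  by (simp add: agree_def)

lemma agree_conc: "agree n x y \<Longrightarrow> agree (length u + n) (u \<frown> x) (u \<frown> y)"
  by (simp add: agree_def conc_def)

lemma agree_conc_Suc:
  assumes "agree n x y" "u \<noteq> []"
  shows "agree (Suc n) (u \<frown> x) (u \<frown> y)"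
  using agree_mono[OF agree_conc[OF assms(1), of u], of "Suc n"] assms(2)
  by (cases u) simp_all

lemma first_difference:
  assumes "x \<noteq> (y :: 'a word)"
  obtains k where "agree k x y" "x k \<noteq> y k"
proof -
  have "\<exists>i. x i \<noteq> y i" using assms by auto
  then obtain k where "x k \<noteq> y k" "\<forall>i<k. \<not> x i \<noteq> y i"
    using exists_least_iff[of "\<lambda>i. x i \<noteq> y i"] by blast
  then show thesis using that by (simp add: agree_def)
qed

lemma first_difference_unique:
  "agree j x y \<Longrightarrow> x j \<noteq> y j \<Longrightarrow> agree k x y \<Longrightarrow> x k \<noteq> y k \<Longrightarrow> j = k"
  unfolding agree_def by (metis linorder_neqE_nat)

declare iter_nth [simp del]

lemma conc_iter [simp]: "u \<noteq> [] \<Longrightarrow> u \<frown> u\<^sup>\<omega> = u\<^sup>\<omega>"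
  using iter_unroll[of u] by simp

text \<open>Unroll to \<open>u \<frown> v \<frown> (u @ v)\<^sup>\<omega>\<close>: an agreement of
  length \<open>n \<le> d\<close> can be passed between the infinite powers of \<open>u\<close> and
  \<open>v\<close>, and prepending \<open>u\<close> gains one place. The bound \<open>Suc d\<close>
  covers position \<open>d\<close> itself, where the two powers may differ.\<close>

lemma agree_iter_append:
  assumes "u \<noteq> []" "v \<noteq> []" "agree d (u\<^sup>\<omega>) (v\<^sup>\<omega>)" "n \<le> Suc d"
  shows "agree n ((u @ v)\<^sup>\<omega>) (u\<^sup>\<omega>)"
  using assms(4)
proof (induction n)
  case (Suc n)
  let ?y = "(u @ v)\<^sup>\<omega>"
  have uv: "agree n (u\<^sup>\<omega>) (v\<^sup>\<omega>)" using agree_mono[OF assms(3)] Suc.prems by simp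
  have "agree n ?y (v\<^sup>\<omega>)" using Suc uv by (auto intro: agree_trans)
  then have "agree (Suc n) (v \<frown> ?y) (v \<frown> v\<^sup>\<omega>)" using assms(2) by (rule agree_conc_Suc)
  then have "agree n (v \<frown> ?y) (v\<^sup>\<omega>)"
    using assms(2) by (simp add: agree_Suc)
  then have "agree n (v \<frown> ?y) (u\<^sup>\<omega>)" using uv by (blast intro: agree_trans agree_sym)
  then have "agree (Suc n) (u \<frown> v \<frown> ?y) (u \<frown> u\<^sup>\<omega>)" using assms(1) by (rule agree_conc_Suc)
  then show ?case using assms(1) by simp
qed simp

lemma iter_append_eq:
  assumes "u \<noteq> []" "v \<noteq> []" "u\<^sup>\<omega> = v\<^sup>\<omega>"
  shows "(u @ v)\<^sup>\<omega> = v\<^sup>\<omega>"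
proof
  fix i
  have "agree (Suc i) ((u @ v)\<^sup>\<omega>) (u\<^sup>\<omega>)"
    by (rule agree_iter_append[of u v i]) (use assms in simp_all)
  then show "(u @ v)\<^sup>\<omega> i = v\<^sup>\<omega> i" using assms(3) by (simp add: agree_Suc)
qed

lemma agree_iter_conc:
  assumes "u \<noteq> []" "agree d (u\<^sup>\<omega>) z"
  shows "agree (Suc d) (u \<frown> z) (u\<^sup>\<omega>)"
  using agree_conc_Suc[OF agree_sym[OF assms(2)] assms(1)] assms(1) by simp

section \<open>The order on infinite words\<close>

locale letter_orders =
  fixes R :: "nat \<Rightarrow> 'a rel"
  assumes strict_linear: "\<And>n. n \<ge> 1 \<Longrightarrow> strict_linear_order_on UNIV (R n)"
begin

text \<open>An infinite word is never a proper prefix, so the first difference decides alone.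
  Positions count from 0, hence \<open>R (Suc k)\<close> at position \<open>k\<close>.\<close>

definition lt :: "'a word \<Rightarrow> 'a word \<Rightarrow> bool" where
  "lt x y \<longleftrightarrow> (\<exists>k. agree k x y \<and> (x k, y k) \<in> R (Suc k))"

definition le :: "'a word \<Rightarrow> 'a word \<Rightarrow> bool" where
  "le x y \<longleftrightarrow> x = y \<or> lt x y"

lemma R_irrefl: "(a, a) \<notin> R (Suc n)"
  using strict_linear[of "Suc n"] by (auto simp: strict_linear_order_on_def irrefl_def)

lemma R_trans: "(a, b) \<in> R (Suc n) \<Longrightarrow> (b, c) \<in> R (Suc n) \<Longrightarrow> (a, c) \<in> R (Suc n)"
  using strict_linear[of "Suc n"] by (auto simp: strict_linear_order_on_def dest: transD)

lemma R_total: "a \<noteq> b \<Longrightarrow> (a, b) \<in> R (Suc n) \<or> (b, a) \<in> R (Suc n)"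
  using strict_linear[of "Suc n"] by (auto simp: strict_linear_order_on_def total_on_def)

lemma lt_irrefl [simp]: "\<not> lt x x"
  by (auto simp: lt_def R_irrefl)

lemma ltI: "agree k x y \<Longrightarrow> (x k, y k) \<in> R (Suc k) \<Longrightarrow> lt x y"
  by (auto simp: lt_def)

lemma lt_first_difference:
  assumes "lt x y" "agree k x y" "x k \<noteq> y k"
  shows "(x k, y k) \<in> R (Suc k)"
proof -
  obtain j where "agree j x y" "(x j, y j) \<in> R (Suc j)" using assms(1) by (auto simp: lt_def)
  moreover from this have "x j \<noteq> y j" using R_irrefl by metis
  ultimately show ?thesis using first_difference_unique assms(2,3) by metis
qed

lemma lt_trans:
  assumes "lt x y" "lt y z"
  shows "lt x z"
proof -
  obtain j where j: "agree j x y" "(x j, y j) \<in> R (Suc j)" using assms(1) by (auto simp: lt_def)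
  obtain k where k: "agree k y z" "(y k, z k) \<in> R (Suc k)" using assms(2) by (auto simp: lt_def)
  have "agree (min j k) x z"
    using j(1) k(1) agree_mono agree_trans by (metis min.cobounded1 min.cobounded2)
  moreover have "(x (min j k), z (min j k)) \<in> R (Suc (min j k))"
  proof (cases j k rule: linorder_cases)
    case less
    then show ?thesis using j k(1) by (auto simp: agree_def min_def)
  next
    case equal
    then show ?thesis using j k R_trans by auto
  next
    case greater
    then show ?thesis using j(1) k by (auto simp: agree_def min_def)
  qed
  ultimately show ?thesis by (rule ltI)
qed

lemma lt_total: "x = y \<or> lt x y \<or> lt y x"
proof (cases "x = y")
  case False
  then obtain k where "agree k x y" "x k \<noteq> y k" by (rule first_difference)
  then show ?thesis using R_total ltI agree_sym by metis
qed simp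

lemma not_lt: "\<not> lt x y \<longleftrightarrow> le y x"
  unfolding le_def using lt_total lt_trans lt_irrefl by metis

lemma le_refl [simp]: "le x x"
  by (simp add: le_def)

lemma le_trans: "le x y \<Longrightarrow> le y z \<Longrightarrow> le x z"
  unfolding le_def using lt_trans by metis

lemma le_lt_trans: "le x y \<Longrightarrow> lt y z \<Longrightarrow> lt x z"
  unfolding le_def using lt_trans by metis

lemma lt_le_trans: "lt x y \<Longrightarrow> le y z \<Longrightarrow> lt x z"
  unfolding le_def using lt_trans by metis

section \<open>Comparing concatenations through infinite powers\<close>

text \<open>\<open>u \<frown> z\<close> coincides with the infinite power of \<open>u\<close>
  through its first difference from \<open>z\<close>, so the same letters decide both
  comparisons.\<close>

lemma conc_less_iff:
  assumes "u \<noteq> []"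
  shows "lt (u \<frown> z) z \<longleftrightarrow> lt (u\<^sup>\<omega>) z"
proof (cases "u\<^sup>\<omega> = z")
  case True
  then have "u \<frown> z = z" using assms by auto
  then show ?thesis using True by simp
next
  case False
  then obtain d where d: "agree d (u\<^sup>\<omega>) z" "(u\<^sup>\<omega>) d \<noteq> z d" by (rule first_difference)
  have e: "agree d (u \<frown> z) (u\<^sup>\<omega>)" "(u \<frown> z) d = (u\<^sup>\<omega>) d"
    using agree_iter_conc[OF assms d(1)] by (simp_all only: agree_Suc)
  then have "agree d (u \<frown> z) z" using d agree_trans by blast
  then show ?thesis using d e lt_first_difference ltI by metis
qed

text \<open>Through the first difference \<open>d\<close> of the two powers, \<open>d\<close>
  included, the power of \<open>u @ v\<close> looks like that of \<open>u\<close> and the power of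
  \<open>v @ u\<close> like that of \<open>v\<close>.\<close>

lemma lt_iter_append:
  assumes "u \<noteq> []" "v \<noteq> []" "lt (u\<^sup>\<omega>) (v\<^sup>\<omega>)"
  shows "lt ((u @ v)\<^sup>\<omega>) (v\<^sup>\<omega>)" "lt (u\<^sup>\<omega>) ((v @ u)\<^sup>\<omega>)" "lt ((u @ v)\<^sup>\<omega>) ((v @ u)\<^sup>\<omega>)"
proof -
  obtain d where d: "agree d (u\<^sup>\<omega>) (v\<^sup>\<omega>)" "((u\<^sup>\<omega>) d, (v\<^sup>\<omega>) d) \<in> R (Suc d)"
    using assms(3) unfolding lt_def by blast
  have uv: "agree d ((u @ v)\<^sup>\<omega>) (u\<^sup>\<omega>)" "((u @ v)\<^sup>\<omega>) d = (u\<^sup>\<omega>) d"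
    using agree_iter_append[OF assms(1,2) d(1) order_refl] by (simp_all only: agree_Suc)
  have vu: "agree d ((v @ u)\<^sup>\<omega>) (v\<^sup>\<omega>)" "((v @ u)\<^sup>\<omega>) d = (v\<^sup>\<omega>) d"
    using agree_iter_append[OF assms(2,1) agree_sym[OF d(1)] order_refl]
    by (simp_all only: agree_Suc)
  show "lt ((u @ v)\<^sup>\<omega>) (v\<^sup>\<omega>)"
    by (rule ltI[of d]) (use d uv in \<open>auto intro: agree_trans\<close>)
  show "lt (u\<^sup>\<omega>) ((v @ u)\<^sup>\<omega>)"
    by (rule ltI[of d]) (use d vu in \<open>auto intro: agree_trans agree_sym\<close>)
  show "lt ((u @ v)\<^sup>\<omega>) ((v @ u)\<^sup>\<omega>)"
  proof (rule ltI[of d])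
    show "agree d ((u @ v)\<^sup>\<omega>) ((v @ u)\<^sup>\<omega>)"
      using agree_trans[OF agree_trans[OF uv(1) d(1)] agree_sym[OF vu(1)]] .
    show "(((u @ v)\<^sup>\<omega>) d, ((v @ u)\<^sup>\<omega>) d) \<in> R (Suc d)"
      using d(2) uv(2) vu(2) by simp
  qed
qed

text \<open>The converse comes from totality: equal powers of \<open>u\<close> and \<open>v\<close>
  make the two sides equal, and reversed ones reverse them.\<close>

lemma iter_append_commute_less:
  assumes "u \<noteq> []" "v \<noteq> []"
  shows "lt ((u @ v)\<^sup>\<omega>) ((v @ u)\<^sup>\<omega>) \<longleftrightarrow> lt (u\<^sup>\<omega>) (v\<^sup>\<omega>)"
proof
  assume *: "lt ((u @ v)\<^sup>\<omega>) ((v @ u)\<^sup>\<omega>)"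
  have "u\<^sup>\<omega> \<noteq> v\<^sup>\<omega>"
  proof
    assume "u\<^sup>\<omega> = v\<^sup>\<omega>"
    then have "(u @ v)\<^sup>\<omega> = (v @ u)\<^sup>\<omega>"
      using iter_append_eq[OF assms] iter_append_eq[OF assms(2,1)] by simp
    then show False using * by simp
  qed
  moreover have "\<not> lt (v\<^sup>\<omega>) (u\<^sup>\<omega>)"
    using * lt_iter_append(3)[OF assms(2,1)] lt_trans lt_irrefl by blast
  ultimately show "lt (u\<^sup>\<omega>) (v\<^sup>\<omega>)" using lt_total by blast
qed (rule lt_iter_append(3)[OF assms])

lemma le_iter_append:
  assumes "u \<noteq> []" "v \<noteq> []" "le (v\<^sup>\<omega>) (u\<^sup>\<omega>)"
  shows "le (v\<^sup>\<omega>) ((u @ v)\<^sup>\<omega>)"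
proof (cases "u\<^sup>\<omega> = v\<^sup>\<omega>")
  case True
  then show ?thesis using iter_append_eq[OF assms(1,2)] by simp
next
  case False
  then have "lt (v\<^sup>\<omega>) (u\<^sup>\<omega>)" using assms(3) by (auto simp: le_def)
  then show ?thesis using lt_iter_append(2)[OF assms(2,1)] by (simp add: le_def)
qed

section \<open>Lyndon words and uniqueness of finite factorizations\<close>

text \<open>Splittings are compared through infinite powers, which can be chained with comparisons
  of other words; \<open>gen_lyndon_FinW\<close> shows that this is the given notion.\<close>

definition lyn :: "'a list \<Rightarrow> bool" where
  "lyn w \<longleftrightarrow> w \<noteq> [] \<and> (\<forall>u v. w = u @ v \<and> u \<noteq> [] \<and> v \<noteq> [] \<longrightarrow> lt (u\<^sup>\<omega>) (v\<^sup>\<omega>))"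

lemma lyn_not_Nil: "lyn w \<Longrightarrow> w \<noteq> []"
  by (simp add: lyn_def)

definition inf_lyn :: "'a word \<Rightarrow> bool" where
  "inf_lyn w \<longleftrightarrow> (\<forall>k>0. lt w (suffix k w))"

lemma inf_lyn_suffixD: "inf_lyn (suffix l w) \<Longrightarrow> l < n \<Longrightarrow> lt (suffix l w) (suffix n w)"
  using inf_lyn_def[of "suffix l w"] by (metis le_add_diff_inverse less_imp_le suffix_suffix zero_less_diff)

definition noninc :: "'a list list \<Rightarrow> bool" where
  "noninc xs \<longleftrightarrow> sorted_wrt (\<lambda>u v. le (v\<^sup>\<omega>) (u\<^sup>\<omega>)) xs"

lemma noninc_snoc:
  "noninc (xs @ [a]) \<longleftrightarrow> noninc xs \<and> (xs \<noteq> [] \<longrightarrow> le (a\<^sup>\<omega>) ((last xs)\<^sup>\<omega>))"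
proof (cases xs rule: rev_cases)
  case (snoc ys b)
  then show ?thesis by (auto simp: noninc_def sorted_wrt_append dest: le_trans)
qed (simp add: noninc_def)

lemma le_iter_suffix_of_lyn:
  assumes "lyn a" "a = s @ u" "u \<noteq> []"
  shows "le (a\<^sup>\<omega>) (u\<^sup>\<omega>)"
proof (cases "s = []")
  case False
  then have "lt (s\<^sup>\<omega>) (u\<^sup>\<omega>)" using assms by (simp add: lyn_def)
  then show ?thesis using lt_iter_append(1) False assms by (simp add: le_def)
qed (use assms in simp)

text \<open>A suffix either lies inside the last factor \<open>a\<close> or is
  \<open>u' @ a\<close>. In the second case induction and monotonicity put the power of
  \<open>u'\<close> at or above that of \<open>a\<close>, and appending \<open>a\<close> keeps it
  there.\<close>

lemma le_iter_suffix_of_concat: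
  assumes "noninc xs" "\<forall>x\<in>set xs. lyn x" "concat xs = s @ u" "u \<noteq> []"
  shows "le ((last xs)\<^sup>\<omega>) (u\<^sup>\<omega>)"
  using assms
proof (induction xs arbitrary: u rule: rev_induct)
  case (snoc a xs)
  have a: "lyn a" using snoc.prems by simp
  have "\<exists>us. (concat xs = s @ us \<and> us @ a = u) \<or> (concat xs @ us = s \<and> a = us @ u)"
    using snoc.prems(3) by (simp add: append_eq_append_conv2)
  then have "(\<exists>t. a = t @ u) \<or> (\<exists>u'. u' \<noteq> [] \<and> u = u' @ a \<and> concat xs = s @ u')"
    by (metis append_Nil)
  then show ?case
  proof (elim disjE exE conjE)
    fix t assume "a = t @ u"
    then show ?thesis using le_iter_suffix_of_lyn[OF a] snoc.prems(4) by simp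
  next
    fix u' assume u': "u' \<noteq> []" "u = u' @ a" "concat xs = s @ u'"
    then have "xs \<noteq> []" by auto
    then have "le (a\<^sup>\<omega>) ((last xs)\<^sup>\<omega>)" using snoc.prems(1) by (simp add: noninc_snoc)
    moreover have "le ((last xs)\<^sup>\<omega>) (u'\<^sup>\<omega>)"
      using snoc.IH[OF _ _ u'(3,1)] snoc.prems by (simp add: noninc_snoc)
    ultimately have "le (a\<^sup>\<omega>) (u'\<^sup>\<omega>)" by (rule le_trans)
    then show ?thesis using le_iter_append u' a by (simp add: lyn_def)
  qed
qed simp

text \<open>A longer \<open>b\<close> would be \<open>u @ a\<close> with \<open>u\<close> a suffix
  of the earlier product. Then the power of \<open>u\<close> is at least that of \<open>a\<close>,
  whereas \<open>b\<close> being Lyndon demands less.\<close>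

lemma last_factor_not_shorter:
  assumes "noninc (xs @ [a])" "\<forall>x\<in>set (xs @ [a]). lyn x" "lyn b"
    and "concat (xs @ [a]) = s @ b"
  shows "length b \<le> length a"
proof (rule ccontr)
  assume "\<not> length b \<le> length a"
  then obtain u where u: "u \<noteq> []" "b = u @ a" "concat xs = s @ u"
    using assms(4) by (auto simp: append_eq_append_conv2)
  then have "xs \<noteq> []" by auto
  then have "le (a\<^sup>\<omega>) (u\<^sup>\<omega>)"
    using assms(1,2) le_iter_suffix_of_concat[OF _ _ u(3,1)] le_trans
    by (simp add: noninc_snoc) blast
  moreover have "lt (u\<^sup>\<omega>) (a\<^sup>\<omega>)" using assms(2,3) u by (simp add: lyn_def)
  ultimately show False using not_lt by blast
qed

lemma finite_factorization_unique:
  assumes "noninc xs" "\<forall>x\<in>set xs. lyn x" "noninc ys" "\<forall>x\<in>set ys. lyn x"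
    and "concat xs = concat ys"
  shows "xs = ys"
  using assms
proof (induction xs arbitrary: ys rule: rev_induct)
  case Nil
  then show ?case by (cases ys) (auto dest: lyn_not_Nil)
next
  case (snoc a xs)
  have "concat ys = concat xs @ a" using snoc.prems(5) by simp
  then have "concat ys \<noteq> []" using snoc.prems(2) lyn_not_Nil by simp
  then obtain zs b where ys: "ys = zs @ [b]" by (cases ys rule: rev_cases) auto
  have "length a = length b"
    using last_factor_not_shorter[of xs a b "concat zs"]
      last_factor_not_shorter[of zs b a "concat xs"] snoc.prems ys by simp
  then have "concat xs = concat zs" "a = b" using snoc.prems(5) ys by simp_all
  then show ?case using snoc.IH[of zs] snoc.prems ys by (simp add: noninc_snoc)
qed

section \<open>Existence of finite factorizations\<close>

lemma last_minimum:
  fixes f :: "nat \<Rightarrow> 'a word"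
  obtains k where "k \<le> n" "\<And>i. i \<le> n \<Longrightarrow> le (f k) (f i)"
    "\<And>i. k < i \<Longrightarrow> i \<le> n \<Longrightarrow> lt (f k) (f i)"
proof -
  have "\<exists>k\<le>n. (\<forall>i\<le>n. le (f k) (f i)) \<and> (\<forall>i\<le>n. k < i \<longrightarrow> lt (f k) (f i))"
  proof (induction n)
    case (Suc n)
    then obtain k where k: "k \<le> n" "\<forall>i\<le>n. le (f k) (f i)" "\<forall>i\<le>n. k < i \<longrightarrow> lt (f k) (f i)"
      by blast
    show ?case
    proof (cases "lt (f k) (f (Suc n))")
      case True
      then show ?thesis using k by (intro exI[of _ k]) (auto simp: le_Suc_eq le_def)
    next
      case False
      then show ?thesis using k le_trans not_lt
        by (intro exI[of _ "Suc n"]) (auto simp: le_Suc_eq)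
    qed
  qed simp
  then show thesis using that by blast
qed

text \<open>Of the nonempty suffixes with least infinite power the shortest is taken, so that its
  own proper suffixes have strictly larger powers.\<close>

lemma minimal_suffix:
  assumes "w \<noteq> []"
  obtains x s where "w = x @ s" "lyn s"
    "\<And>t u. w = t @ u \<Longrightarrow> u \<noteq> [] \<Longrightarrow> le (s\<^sup>\<omega>) (u\<^sup>\<omega>)"
proof -
  obtain k where k: "k \<le> length w - 1"
    "\<And>i. i \<le> length w - 1 \<Longrightarrow> le ((drop k w)\<^sup>\<omega>) ((drop i w)\<^sup>\<omega>)"
    "\<And>i. k < i \<Longrightarrow> i \<le> length w - 1 \<Longrightarrow> lt ((drop k w)\<^sup>\<omega>) ((drop i w)\<^sup>\<omega>)"
    by (rule last_minimum[of "length w - 1" "\<lambda>i. (drop i w)\<^sup>\<omega>"]) blast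
  have len: "length w > 0" using assms by simp
  have "lyn (drop k w)"
    unfolding lyn_def
  proof (intro conjI allI impI; (elim conjE)?)
    show "drop k w \<noteq> []" using k(1) len by (cases w) simp_all
    fix u v assume uv: "drop k w = u @ v" "u \<noteq> []" "v \<noteq> []"
    have v: "v = drop (k + length u) w" using uv(1)
      by (metis append_eq_conv_conj drop_drop add.commute)
    then have "k + length u < length w" using uv(3) by (metis drop_all not_le)
    then have "lt ((u @ v)\<^sup>\<omega>) (v\<^sup>\<omega>)" using k(3)[of "k + length u"] uv v by simp
    \<comment> \<open>Otherwise appending \<open>v\<close> to \<open>u\<close> would leave the power
      of \<open>u @ v\<close> at or above that of \<open>v\<close>.\<close>
    then show "lt (u\<^sup>\<omega>) (v\<^sup>\<omega>)" using le_iter_append[OF uv(2,3)] not_lt by blast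
  qed
  moreover have "le ((drop k w)\<^sup>\<omega>) (u\<^sup>\<omega>)" if "w = t @ u" "u \<noteq> []" for t u
    using k(2)[of "length t"] that by (cases u) simp_all
  ultimately show thesis using that[of "take k w" "drop k w"] by simp
qed

lemma finite_factorization_exists:
  obtains xs where "noninc xs" "\<forall>x\<in>set xs. lyn x" "concat xs = w"
proof -
  have "\<exists>xs. noninc xs \<and> (\<forall>x\<in>set xs. lyn x) \<and> concat xs = w"
  proof (induction w rule: length_induct)
    case (1 w)
    show ?case
    proof (cases "w = []")
      case True
      then show ?thesis by (intro exI[of _ "[]"]) (simp add: noninc_def)
    next
      case False
      then obtain x s where s: "w = x @ s" "lyn s"
        "\<And>t u. w = t @ u \<Longrightarrow> u \<noteq> [] \<Longrightarrow> le (s\<^sup>\<omega>) (u\<^sup>\<omega>)"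
        by (rule minimal_suffix) blast
      have "s \<noteq> []" using s(2) by (simp add: lyn_def)
      then obtain xs where xs: "noninc xs" "\<forall>x\<in>set xs. lyn x" "concat xs = x"
        using 1[rule_format, of x] s(1) by auto
      have "le (s\<^sup>\<omega>) ((last xs)\<^sup>\<omega>)" if "xs \<noteq> []"
      proof -
        have l: "last xs \<noteq> []" using xs(2) that lyn_not_Nil by simp
        have "x = concat (butlast xs) @ last xs"
          using xs(3) that append_butlast_last_id[OF that] by (metis concat_append concat.simps append_Nil2)
        \<comment> \<open>Minimality of \<open>s\<close> applies to the suffix
          \<open>last xs @ s\<close>; a smaller power of \<open>last xs\<close> would pull the power
          of this suffix below that of \<open>s\<close>.\<close>
        then have "le (s\<^sup>\<omega>) ((last xs @ s)\<^sup>\<omega>)"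
          using s(3)[of "concat (butlast xs)" "last xs @ s"] s(1) \<open>s \<noteq> []\<close> by simp
        then show ?thesis using lt_iter_append(1)[OF l \<open>s \<noteq> []\<close>] not_lt by blast
      qed
      then have "noninc (xs @ [s])" using xs by (simp add: noninc_snoc)
      then show ?thesis using xs s by (intro exI[of _ "xs @ [s]"]) simp
    qed
  qed
  then show thesis using that by blast
qed

section \<open>Factorizations ending in an infinite Lyndon word\<close>

definition inf_factorization :: "'a word \<Rightarrow> 'a list list \<Rightarrow> 'a word \<Rightarrow> bool" where
  "inf_factorization w xs m \<longleftrightarrow> noninc xs \<and> (\<forall>x\<in>set xs. lyn x) \<and> inf_lyn m \<and>
     (xs \<noteq> [] \<longrightarrow> le m ((last xs)\<^sup>\<omega>)) \<and> w = concat xs \<frown> m"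

text \<open>A suffix starting earlier is \<open>u \<frown> m\<close>, where the power of
  \<open>u\<close> is at least \<open>m\<close>. Hence \<open>u \<frown> m\<close> is not below its
  proper suffix \<open>m\<close>.\<close>

lemma lyndon_suffix_not_before_last_factor:
  assumes "inf_factorization w xs m" "inf_lyn (suffix j w)"
  shows "length (concat xs) \<le> j"
proof (rule ccontr)
  define u where "u = drop j (concat xs)"
  assume *: "\<not> length (concat xs) \<le> j"
  then have u: "concat xs = take j (concat xs) @ u" "u \<noteq> []" by (simp_all add: u_def)
  then have "xs \<noteq> []" by auto
  then have "le m (u\<^sup>\<omega>)"
    using assms(1) le_iter_suffix_of_concat[OF _ _ u] le_trans
    unfolding inf_factorization_def by blast
  then have "\<not> lt (u \<frown> m) m" using conc_less_iff[OF u(2)] not_lt by simp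
  moreover have "suffix j w = u \<frown> m"
    using * assms(1) by (simp add: inf_factorization_def u_def)
  moreover have "lt (suffix j w) (suffix (length u) (suffix j w))"
    using assms(2) u(2) unfolding inf_lyn_def by blast
  ultimately show False by simp
qed

text \<open>The start of the infinite factor is thus determined by \<open>w\<close> alone, which
  gives both uniqueness and the description of the last term.\<close>

lemma inf_factorization_least:
  assumes "inf_factorization w xs m"
  shows "(LEAST j. inf_lyn (suffix j w)) = length (concat xs)"
proof (rule Least_equality)
  show "inf_lyn (suffix (length (concat xs)) w)"
    using assms by (simp add: inf_factorization_def)
qed (rule lyndon_suffix_not_before_last_factor[OF assms])

lemma inf_factorization_unique:
  assumes "inf_factorization w xs m" "inf_factorization w ys n"
  shows "xs = ys \<and> m = n"
proof -
  have "length (concat xs) = length (concat ys)"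
    using assms[THEN inf_factorization_least] by simp
  moreover have "concat xs \<frown> m = concat ys \<frown> n"
    using assms by (simp add: inf_factorization_def)
  ultimately have "concat xs = concat ys" "m = n" by simp_all
  then show ?thesis
    using assms finite_factorization_unique[of xs ys] by (simp add: inf_factorization_def)
qed

lemma inf_factorization_exists:
  assumes "inf_lyn (suffix j w)"
  obtains xs m where "inf_factorization w xs m"
proof -
  define l where "l = (LEAST j. inf_lyn (suffix j w))"
  have l: "inf_lyn (suffix l w)" "\<And>i. inf_lyn (suffix i w) \<Longrightarrow> l \<le> i"
    unfolding l_def using assms by (auto intro: LeastI Least_le)
  \<comment> \<open>The last minimal suffix starting at or before \<open>l\<close> is Lyndon: it is
    below the later ones up to \<open>l\<close> by choice, and below those beyond \<open>l\<close>
    through \<open>suffix l w\<close>. Minimality of \<open>l\<close> then forces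
    \<open>k = l\<close>.\<close>
  obtain k where k: "k \<le> l" "\<And>i. i \<le> l \<Longrightarrow> le (suffix k w) (suffix i w)"
    "\<And>i. k < i \<Longrightarrow> i \<le> l \<Longrightarrow> lt (suffix k w) (suffix i w)"
    by (rule last_minimum[of l "\<lambda>i. suffix i w"]) blast
  have "inf_lyn (suffix k w)"
    unfolding inf_lyn_def
  proof (intro allI impI)
    fix i :: nat assume "0 < i"
    show "lt (suffix k w) (suffix i (suffix k w))"
    proof (cases "k + i \<le> l")
      case True
      then show ?thesis using k(3)[of "k + i"] \<open>0 < i\<close> by simp
    next
      case False
      then have "lt (suffix l w) (suffix (k + i) w)" by (intro inf_lyn_suffixD[OF l(1)]) simp
      then show ?thesis using k(2)[of l] le_lt_trans by simp
    qed
  qed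
  then have min: "le (suffix l w) (suffix i w)" if "i \<le> l" for i
    using l(2)[of k] k(1) k(2)[OF that] by simp
  obtain xs where xs: "noninc xs" "\<forall>x\<in>set xs. lyn x" "concat xs = prefix l w"
    by (rule finite_factorization_exists)
  have "le (suffix l w) ((last xs)\<^sup>\<omega>)" if "xs \<noteq> []"
  proof -
    define b where "b = concat (butlast xs)"
    have b: "prefix l w = b @ last xs"
      unfolding b_def xs(3)[symmetric]
      using append_butlast_last_id[OF that] by (metis concat_append concat.simps append_Nil2)
    then have len: "l = length b + length (last xs)"
      by (metis length_append subsequence_length diff_zero)
    have "w = b \<frown> last xs \<frown> suffix l w" using prefix_suffix[of w l] b by simp
    then have "suffix (length b) w = last xs \<frown> suffix l w"
      by (metis suffix_conc_length)
    \<comment> \<open>Minimality is used at the start of the last finite factor;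
      \<open>conc_less_iff\<close> then turns this into a bound on the power of that factor.\<close>
    then have "le (suffix l w) (last xs \<frown> suffix l w)"
      using min[of "length b"] len by simp
    moreover have "last xs \<noteq> []" using xs(2) that lyn_not_Nil by simp
    ultimately show ?thesis using conc_less_iff not_lt by blast
  qed
  then have "inf_factorization w xs (suffix l w)"
    using xs l(1) by (simp add: inf_factorization_def)
  then show thesis by (rule that)
qed

section \<open>Exclusion of infinite factorizations\<close>

text \<open>Stated for nonempty words with nonincreasing powers, since \<open>y 0\<close> will be
  the rest of a Lyndon factor and may itself fail to be Lyndon.\<close>

lemma no_smaller_than_tails:
  fixes y :: "nat \<Rightarrow> 'a list" and v :: "nat \<Rightarrow> 'a word"
  assumes y: "\<And>n. y n \<noteq> []" "\<And>n. le ((y (Suc n))\<^sup>\<omega>) ((y n)\<^sup>\<omega>)"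
    and v: "\<And>n. v n = y n \<frown> v (Suc n)" "\<And>n. lt (v 0) (v (Suc n))"
  shows False
proof -
  txt \<open>Otherwise \<open>v 0 < (y n)\<^sup>\<omega>\<close> with the same first difference \<open>d\<close>, and going down to \<open>n = 0\<close>
    (the \<open>(y n)\<^sup>\<omega>\<close> increase, so their first differences from \<open>v 0\<close> do not move right) gives
    \<open>v 0 \<noteq> v 0\<close>.\<close>
  have no: "\<not> (agree d (v 0) (v n) \<and> v 0 d \<noteq> v n d \<and> agree (Suc d) ((y n)\<^sup>\<omega>) (v n))" for n d
  proof (induction n arbitrary: d)
    case (Suc n)
    show ?case
    proof (intro notI, elim conjE)
      assume d: "agree d (v 0) (v (Suc n))" "v 0 d \<noteq> v (Suc n) d"
        "agree (Suc d) ((y (Suc n))\<^sup>\<omega>) (v (Suc n))"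
      have eq: "agree d ((y (Suc n))\<^sup>\<omega>) (v (Suc n))" "((y (Suc n))\<^sup>\<omega>) d = v (Suc n) d"
        using d(3) by (simp_all only: agree_Suc)
      have 1: "agree d (v 0) ((y (Suc n))\<^sup>\<omega>)"
        using d(1) eq(1) agree_sym agree_trans by blast
      have "lt (v 0) ((y (Suc n))\<^sup>\<omega>)"
        by (rule ltI[OF 1]) (use lt_first_difference[OF v(2) d(1,2)] eq(2) in simp)
      then have lt: "lt (v 0) ((y n)\<^sup>\<omega>)" using y(2) lt_le_trans by blast
      then obtain c where c: "agree c (v 0) ((y n)\<^sup>\<omega>)" "v 0 c \<noteq> ((y n)\<^sup>\<omega>) c"
        using first_difference lt_irrefl by metis
      have "c \<le> d"
      proof (rule ccontr)
        assume "\<not> c \<le> d"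
        then have "agree (Suc d) (v 0) ((y n)\<^sup>\<omega>)" using c(1) agree_mono by force
        then have g: "agree d (v 0) ((y n)\<^sup>\<omega>)" "v 0 d = ((y n)\<^sup>\<omega>) d"
          by (simp_all only: agree_Suc)
        have "(v 0 d, ((y (Suc n))\<^sup>\<omega>) d) \<in> R (Suc d)"
          using lt_first_difference[OF v(2) d(1,2)] eq(2) by simp
        then have "lt ((y n)\<^sup>\<omega>) ((y (Suc n))\<^sup>\<omega>)"
          using g 1 agree_sym agree_trans ltI by metis
        then show False using y(2) not_lt by blast
      qed
      \<comment> \<open>Up to \<open>c\<close> both words coincide with \<open>v 0\<close>.
        Prepending \<open>y n\<close> carries the agreement past \<open>c\<close>, so
        \<open>c\<close> takes for \<open>n\<close> the role that \<open>d\<close> had for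
        \<open>Suc n\<close>.\<close>
      then have "agree c ((y n)\<^sup>\<omega>) (v (Suc n))"
        using c(1) d(1) agree_mono agree_sym agree_trans by metis
      then have "agree (Suc c) (v n) ((y n)\<^sup>\<omega>)"
        using agree_iter_conc[OF y(1)] v(1)[of n] by simp
      then have n: "agree (Suc c) ((y n)\<^sup>\<omega>) (v n)" by (rule agree_sym)
      then have "agree c (v 0) (v n)" "v 0 c \<noteq> v n c"
        using c agree_trans by (auto simp: agree_Suc)
      then show False using Suc.IH n by blast
    qed
  qed simp
  have "\<exists>e. agree e (v 0) (v (Suc n)) \<and> v 0 e \<noteq> v (Suc n) e" for n
    using v(2)[of n] first_difference lt_irrefl by metis
  then obtain e where e: "\<And>n. agree (e n) (v 0) (v (Suc n))" "\<And>n. v 0 (e n) \<noteq> v (Suc n) (e n)"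
    by metis
  have dec: "e (Suc n) < e n" for n
  proof (rule ccontr)
    assume less: "\<not> e (Suc n) < e n"
    \<comment> \<open>With \<open>e n \<le> e (Suc n)\<close>, agreement passes from
      \<open>v (Suc n)\<close> via \<open>v 0\<close> to \<open>v (Suc (Suc n))\<close>, and
      prepending \<open>y (Suc n)\<close> gains a place. Repeating this covers position
      \<open>e n\<close>, which \<open>no\<close> forbids.\<close>
    have "agree q ((y (Suc n))\<^sup>\<omega>) (v (Suc n))" if "q \<le> Suc (e n)" for q
      using that
    proof (induction q)
      case (Suc q)
      have "agree q ((y (Suc n))\<^sup>\<omega>) (v (Suc n))" using Suc by simp
      moreover have "agree q (v (Suc n)) (v 0)"
        using agree_mono[OF agree_sym[OF e(1)[of n]]] Suc.prems by simp
      moreover have "agree q (v 0) (v (Suc (Suc n)))"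
        using agree_mono[OF e(1)[of "Suc n"]] Suc.prems less by simp
      ultimately have "agree q ((y (Suc n))\<^sup>\<omega>) (v (Suc (Suc n)))" using agree_trans by blast
      then show ?case
        using agree_iter_conc[OF y(1)] v(1)[of "Suc n"] agree_sym by metis
    qed simp
    then show False using no[of "e n" "Suc n"] e by blast
  qed
  have "e n + n \<le> e 0" for n
  proof (induction n)
    case (Suc n)
    then show ?case using dec[of n] by simp
  qed simp
  from this[of "Suc (e 0)"] show False by simp
qed

lemma no_infinite_factorization:
  fixes x :: "nat \<Rightarrow> 'a list"
  assumes lyn: "\<And>i. lyn (x i)" and noninc: "\<And>i. le ((x (Suc i))\<^sup>\<omega>) ((x i)\<^sup>\<omega>)"
    and prod: "\<And>k. \<exists>s. w = concat (map x [0..<k]) \<frown> s" and suf: "inf_lyn (suffix j w)"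
  shows False
proof -
  define p where "p k = length (concat (map x [0..<k]))" for k
  define s where "s k = suffix (p k) w" for k
  have w: "w = concat (map x [0..<k]) \<frown> s k" for k
    using prod[of k] by (auto simp: s_def p_def)
  have s: "s k = x k \<frown> s (Suc k)" for k
  proof -
    have "concat (map x [0..<k]) \<frown> s k = concat (map x [0..<k]) \<frown> x k \<frown> s (Suc k)"
      using w[of k] w[of "Suc k"] by simp
    then show ?thesis by (simp only: same_concat_eq)
  qed
  have p_Suc: "p k < p (Suc k)" for k
    using lyn_not_Nil[OF lyn] by (simp add: p_def)
  then have mono: "strict_mono p" by (simp add: strict_mono_Suc_iff)
  then have "j < p (Suc j)" using strict_mono_imp_increasing[of p "Suc j"] by simp
  moreover have "p 0 = 0" by (simp add: p_def)
  ultimately obtain k where k: "p k \<le> j" "j < p (Suc k)"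
    using ex_least_nat_less[of "\<lambda>n. j < p n" "Suc j"] by (auto simp: not_less)
  \<comment> \<open>The Lyndon suffix may start inside \<open>x k\<close>, the factor containing
    position \<open>j\<close>; its first piece is then the rest of \<open>x k\<close>.\<close>
  define y where "y n = (case n of 0 \<Rightarrow> drop (j - p k) (x k) | Suc n \<Rightarrow> x (Suc k + n))" for n
  define v where "v n = (case n of 0 \<Rightarrow> suffix j w | Suc n \<Rightarrow> s (Suc k + n))" for n
  have len: "j - p k < length (x k)" using k by (simp add: p_def)
  show False
  proof (rule no_smaller_than_tails[of y v])
    fix n
    show "y n \<noteq> []" using len lyn_not_Nil[OF lyn] by (simp add: y_def split: nat.split)
    show "le ((y (Suc n))\<^sup>\<omega>) ((y n)\<^sup>\<omega>)"
    proof (cases n)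
      case 0
      \<comment> \<open>Cutting a Lyndon factor does not lower its power, so the sequence stays
        nonincreasing.\<close>
      have "le ((x k)\<^sup>\<omega>) ((drop (j - p k) (x k))\<^sup>\<omega>)"
        by (rule le_iter_suffix_of_lyn[OF lyn, of _ "take (j - p k) (x k)"]) (use len in simp_all)
      then show ?thesis using 0 noninc[of k] le_trans by (auto simp: y_def)
    qed (use noninc in \<open>simp add: y_def\<close>)
    show "v n = y n \<frown> v (Suc n)"
    proof (cases n)
      case 0
      have "suffix j w = suffix (j - p k) (s k)" using k(1) by (simp add: s_def)
      also have "\<dots> = drop (j - p k) (x k) \<frown> s (Suc k)"
        using len by (subst s) simp
      finally show ?thesis using 0 by (simp add: v_def y_def)
    next
      case (Suc i)
      then show ?thesis using s[of "Suc k + i"] by (simp add: v_def y_def)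
    qed
    have "p (Suc k) \<le> p (Suc k + n)" using mono by (simp add: strict_mono_less_eq)
    then have "j < p (Suc k + n)" using k(2) by simp
    then show "lt (v 0) (v (Suc n))"
      using inf_lyn_suffixD[OF suf] by (simp add: v_def s_def)
  qed
qed

section \<open>Translation to the given definitions\<close>

lemma gless_InfW: "gless R (InfW x) (InfW y) \<longleftrightarrow> lt x y"
proof
  assume "gless R (InfW x) (InfW y)"
  then obtain p a b s s' where *: "InfW x = gconc (FinW (p @ [a])) s"
    "InfW y = gconc (FinW (p @ [b])) s'" "(a, b) \<in> R (length p + 1)"
    by (auto simp: gless_def gproper_prefix_def)
  then obtain t t' where "x = (p @ [a]) \<frown> t" "y = (p @ [b]) \<frown> t'"
    by (cases s; cases s') auto
  then show "lt x y" using *(3)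
    by (intro ltI[of "length p"]) (simp_all add: agree_def conc_def nth_append)
next
  assume "lt x y"
  then obtain k where k: "agree k x y" "(x k, y k) \<in> R (Suc k)" by (auto simp: lt_def)
  have "prefix k x = prefix k y"
    using k(1) by (simp add: subsequence_def agree_def)
  then have "x = (prefix k x @ [x k]) \<frown> suffix (Suc k) x"
    "y = (prefix k x @ [y k]) \<frown> suffix (Suc k) y"
    using prefix_suffix[of x "Suc k"] prefix_suffix[of y "Suc k"] by simp_all
  then show "gless R (InfW x) (InfW y)"
    unfolding gless_def using k(2)
    by (intro disjI2 exI[of _ "prefix k x"] exI[of _ "x k"] exI[of _ "y k"]
        exI[of _ "InfW (suffix (Suc k) x)"] exI[of _ "InfW (suffix (Suc k) y)"])
      (simp del: build_append conc_conc subseq_to_Suc)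
qed

text \<open>Equal lengths exclude the prefix case, and the powers of distinct words of equal length
  first differ within the first period.\<close>

lemma gless_FinW:
  assumes "length x = length y" "x \<noteq> []"
  shows "gless R (FinW x) (FinW y) \<longleftrightarrow> lt (x\<^sup>\<omega>) (y\<^sup>\<omega>)"
proof
  assume gl: "gless R (FinW x) (FinW y)"
  have "\<not> gproper_prefix (FinW x) (FinW y)"
  proof
    assume "gproper_prefix (FinW x) (FinW y)"
    then obtain s where "s \<noteq> FinW []" "FinW y = gconc (FinW x) s"
      by (auto simp: gproper_prefix_def)
    then show False using assms(1) by (cases s) auto
  qed
  then obtain p a b s s' where *: "FinW x = gconc (FinW (p @ [a])) s"
    "FinW y = gconc (FinW (p @ [b])) s'" "(a, b) \<in> R (length p + 1)"
    using gl by (auto simp: gless_def)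
  then obtain t t' where "x = p @ a # t" "y = p @ b # t'"
    by (cases s; cases s') auto
  then show "lt (x\<^sup>\<omega>) (y\<^sup>\<omega>)" using *(3)
    by (intro ltI[of "length p"]) (simp_all add: agree_def iter_nth nth_append)
next
  assume "lt (x\<^sup>\<omega>) (y\<^sup>\<omega>)"
  then obtain k where k: "agree k (x\<^sup>\<omega>) (y\<^sup>\<omega>)" "((x\<^sup>\<omega>) k, (y\<^sup>\<omega>) k) \<in> R (Suc k)"
    by (auto simp: lt_def)
  have len: "0 < length x" "0 < length y" using assms(2) unfolding assms(1)[symmetric] by simp_all
  have nth: "x ! i = y ! i" if "i < k" "i < length x" for i
    using k(1) that len assms(1) by (auto simp: agree_def iter_nth)
  have "k < length x"
  proof (rule ccontr)
    assume "\<not> k < length x"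
    then have "x = y" using nth assms(1) by (intro nth_equalityI) auto
    then show False using k(2) R_irrefl by simp
  qed
  then have "take k x = take k y"
    using nth assms(1) by (intro nth_equalityI) auto
  then have "FinW x = gconc (FinW (take k x @ [x ! k])) (FinW (drop (Suc k) x))"
    "FinW y = gconc (FinW (take k x @ [y ! k])) (FinW (drop (Suc k) y))"
    using id_take_nth_drop[of k x] id_take_nth_drop[of k y] \<open>k < length x\<close> assms(1) by simp_all
  moreover have "(x ! k, y ! k) \<in> R (length (take k x) + 1)"
    using k(2) \<open>k < length x\<close> len assms(1) by (simp add: iter_nth)
  ultimately show "gless R (FinW x) (FinW y)" unfolding gless_def by blast
qed

lemma gen_lyndon_FinW: "gen_lyndon R (FinW w) \<longleftrightarrow> lyn w"
proof -
  have "gless R (FinW (u @ v)) (FinW (v @ u)) \<longleftrightarrow> lt (u\<^sup>\<omega>) (v\<^sup>\<omega>)"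
    if "u \<noteq> []" "v \<noteq> []" for u v
    using gless_FinW[of "u @ v" "v @ u"] iter_append_commute_less[OF that] that by simp
  then show ?thesis by (auto simp: lyn_def)
qed

lemma gen_lyndon_InfW: "gen_lyndon R (InfW w) \<longleftrightarrow> inf_lyn w"
proof
  assume *: "gen_lyndon R (InfW w)"
  show "inf_lyn w"
    unfolding inf_lyn_def
  proof (intro allI impI)
    fix k :: nat assume "0 < k"
    then have "prefix k w \<noteq> []" by simp
    then have "gless R (InfW w) (InfW (suffix k w))"
      using * prefix_suffix[of w k] unfolding gen_lyndon.simps by blast
    then show "lt w (suffix k w)" by (simp only: gless_InfW)
  qed
next
  assume *: "inf_lyn w"
  have "lt w v" if "w = u \<frown> v" "u \<noteq> []" for u v
    using * that suffix_conc_length[of u v] unfolding inf_lyn_def by (metis length_greater_0_conv)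
  then show "gen_lyndon R (InfW w)" by (auto simp: gless_InfW)
qed

lemma gle_InfW: "gle R (InfW x) (InfW y) \<longleftrightarrow> le x y"
  by (simp add: gle_def le_def gless_InfW)

end

lemma gprod_FinW: "gprod (map FinW xs) = FinW (concat xs)"
  by (induction xs) (simp_all add: gprod_def)

lemma gprod_snoc_InfW: "gprod (map FinW xs @ [InfW m]) = InfW (concat xs \<frown> m)"
  by (induction xs) (simp_all add: gprod_def)

context letter_orders
begin

text \<open>Lets the condition on neighbouring factors be read as one on all pairs, the form used in
  \<open>noninc\<close>.\<close>

lemma transp_gle_gomega: "transp (\<lambda>a b. gle R (gomega b) (gomega a))"
proof (rule transpI)
  fix a b c
  assume "gle R (gomega b) (gomega a)" "gle R (gomega c) (gomega b)"
  then show "gle R (gomega c) (gomega a)"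
    by (cases a; cases b; cases c) (auto simp: gle_InfW intro: le_trans)
qed

lemma finite_factorization_iff:
  "nonincreasing_lyndon_factorization R (InfW w) (FinW ls) \<longleftrightarrow>
     (\<exists>xs m. ls = map FinW xs @ [InfW m] \<and> inf_factorization w xs m)"
proof -
  have shape: "nonincreasing_lyndon_factorization R (InfW w) (FinW (map FinW xs @ [InfW m]))
      \<longleftrightarrow> inf_factorization w xs m" for xs m
  proof -
    have "(\<forall>x\<in>set xs. le m (x\<^sup>\<omega>)) \<longleftrightarrow> (xs \<noteq> [] \<longrightarrow> le m ((last xs)\<^sup>\<omega>))" if "noninc xs"
      using that
      by (cases xs rule: rev_cases) (auto simp: noninc_def sorted_wrt_append dest: le_trans)
    then show ?thesis
      unfolding nonincreasing_lyndon_factorization.simps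
        sorted_wrt_iff_nth_Suc_transp[OF transp_gle_gomega, symmetric] gprod_snoc_InfW
      by (auto simp: sorted_wrt_append sorted_wrt_map gle_InfW noninc_def inf_factorization_def
          gen_lyndon_FinW gen_lyndon_InfW simp del: gen_lyndon.simps)
  qed
  have "\<exists>xs m. ls = map FinW xs @ [InfW m]"
    if "nonincreasing_lyndon_factorization R (InfW w) (FinW ls)"
  proof -
    have ls: "ls \<noteq> []" "\<forall>l\<in>set (butlast ls). \<exists>u. l = FinW u" "gprod ls = InfW w"
      using that by simp_all
    obtain xs where "butlast ls = map FinW xs" using ls(2) ex_map_conv[of "butlast ls" FinW] by auto
    then have xs: "ls = map FinW xs @ [last ls]" using append_butlast_last_id[OF ls(1)] by simp
    show ?thesis
    proof (cases "last ls")
      case (FinW u)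
      \<comment> \<open>A finite last factor would make the whole product finite.\<close>
      then have "ls = map FinW (xs @ [u])" using xs by simp
      then show ?thesis using ls(3) gprod_FinW by (metis gword.distinct(1))
    next
      case (InfW m)
      then show ?thesis using xs by metis
    qed
  qed
  then show ?thesis using shape by blast
qed

lemma not_infinite_factorization:
  assumes "inf_lyn (suffix j w)"
  shows "\<not> nonincreasing_lyndon_factorization R (InfW w) (InfW ls)"
proof
  assume F: "nonincreasing_lyndon_factorization R (InfW w) (InfW ls)"
  then obtain x where x: "ls = (\<lambda>i. FinW (x i))"
    unfolding nonincreasing_lyndon_factorization.simps by metis
  have "map ls [0..<k] = map FinW (map x [0..<k])" for k by (simp add: x)
  then have prod: "gprod (map ls [0..<k]) = FinW (concat (map x [0..<k]))" for k
    by (simp only: gprod_FinW)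
  show False
  proof (rule no_infinite_factorization[of x w j])
    fix i
    show "lyn (x i)" using F by (simp add: x gen_lyndon_FinW del: gen_lyndon.simps)
    show "le ((x (Suc i))\<^sup>\<omega>) ((x i)\<^sup>\<omega>)" using F by (simp add: x gle_InfW)
    have "gproper_prefix (FinW (concat (map x [0..<i]))) (InfW w)"
      using F prod by simp
    then obtain s where "InfW w = gconc (FinW (concat (map x [0..<i]))) s"
      by (auto simp: gproper_prefix_def)
    then show "\<exists>s. w = concat (map x [0..<i]) \<frown> s" by (cases s) auto
  qed (rule assms)
qed

end

theorem theorem3:
  fixes R :: "nat \<Rightarrow> 'a rel" and w :: "'a word"
  assumes "\<And>n. n \<ge> 1 \<Longrightarrow> strict_linear_order_on UNIV (R n)"
    and "\<exists>j. gen_lyndon R (InfW (suffix j w))"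
  shows "(\<exists>!F. nonincreasing_lyndon_factorization R (InfW w) F) \<and>
    (\<forall>F. nonincreasing_lyndon_factorization R (InfW w) F \<longrightarrow>
       (\<exists>ls. F = FinW ls \<and>
             last ls = InfW (suffix (LEAST j. gen_lyndon R (InfW (suffix j w))) w)))"
proof -
  interpret letter_orders R by unfold_locales (rule assms(1))
  obtain j where j: "inf_lyn (suffix j w)" using assms(2) unfolding gen_lyndon_InfW by blast
  obtain xs m where xs: "inf_factorization w xs m" using inf_factorization_exists[OF j] .
  have "nonincreasing_lyndon_factorization R (InfW w) F \<longleftrightarrow> F = FinW (map FinW xs @ [InfW m])" for F
  proof (cases F)
    case (FinW ls)
    have "(\<exists>ys n. ls = map FinW ys @ [InfW n] \<and> inf_factorization w ys n)
        \<longleftrightarrow> ls = map FinW xs @ [InfW m]"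
      using xs inf_factorization_unique[OF xs] by blast
    then show ?thesis by (simp only: FinW finite_factorization_iff gword.inject)
  next
    case (InfW ls)
    then show ?thesis using not_infinite_factorization[OF j] by blast
  qed
  \<comment> \<open>The least index is the length of \<open>concat xs\<close>, and removing that
    many letters from \<open>w\<close> leaves \<open>m\<close>.\<close>
  moreover have "m = suffix (LEAST j. inf_lyn (suffix j w)) w"
    using xs by (simp add: inf_factorization_least[OF xs]) (simp add: inf_factorization_def)
  ultimately show ?thesis unfolding gen_lyndon_InfW by (simp only: ex1_eq) simp
qed

end
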